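(* Let $i\in\{7,23\}$ and $n$ a positive integer. Then $\mathcal{J}_{10}(40n+i)$ and $\mathcal{J}^*_{10}(40n+i)$ are both even.
   Context: Let $q=e^{2\pi i\tau}$, $(a;q)_\infty=\prod_{j\ge0}(1-aq^j)$, and $\eta(\tau)=q^{1/24}(q;q)_\infty$. Define $$j_{10}(\tau)=\frac{\eta(2\tau)\eta(5\tau)^5}{\eta(\tau)\eta(10\tau)^5}-1=\frac1q+\sum_{n\ge0}\mathcal{J}_{10}(n)q^n,$$ $$j_{10}^{*}(\tau)=\left(\frac{\eta(\tau)\eta(5\tau)}{\eta(2\tau)\eta(10\tau)}\right)^{4}+4+2^4\left(\frac{\eta(2\tau)\eta(10\tau)}{\eta(\tau)\eta(5\tau)}\right)^{4}=\frac1q+\sum_{n\ge0}\mathcal{J}^*_{10}(n)q^n.$$ *)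

theory Defs
  imports "HOL-Computational_Algebra.Formal_Laurent_Series"
begin

text \<open>The q-Pochhammer symbol (q^k;q^k)_infinity as a formal power series in q.
  Its n-th coefficient agrees with that of the finite product over 1 <= j <= n,
  since factors with k*j > n do not affect the coefficient of q^n (k >= 1).\<close>
definition qpoch :: "nat \<Rightarrow> rat fps" where
  "qpoch k = Abs_fps (\<lambda>n. fps_nth (\<Prod>j\<in>{1..n}. (1 - fps_X ^ (k * j))) n)"

text \<open>eta(k tau) with the factor q^(k/24) removed, as a formal Laurent series.\<close>
definition E :: "nat \<Rightarrow> rat fls" where
  "E k = fps_to_fls (qpoch k)"

text \<open>The q-power prefactors of the eta quotients combine to q^(-1) (resp. q^(-1), q^1).\<close>
definition j10 :: "rat fls" where
  "j10 = fls_X_inv * (E 2 * E 5 ^ 5 / (E 1 * E 10 ^ 5)) - 1"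

definition j10star :: "rat fls" where
  "j10star = fls_X_inv * (E 1 * E 5 / (E 2 * E 10)) ^ 4 + 4
             + 2 ^ 4 * (fls_X * (E 2 * E 10 / (E 1 * E 5)) ^ 4)"

definition J10 :: "int \<Rightarrow> rat" where
  "J10 n = fls_nth j10 n"

definition J10star :: "int \<Rightarrow> rat" where
  "J10star n = fls_nth j10star n"

end

theory Submission
  imports Defs "HOL-Library.Z2"
begin

text \<open>Write \<open>f\<^sub>k = (q\<^sup>k; q\<^sup>k)\<^sub>\<infinity>\<close> and work over the field with two elements, where \<open>f\<^bsub>2k\<^esub> = f\<^sub>k\<^sup>2\<close>.
  Then \<open>j\<^sub>1\<^sub>0 + 1\<close> reduces to \<open>q\<^sup>-\<^sup>1 f\<^sub>1 / f\<^sub>5\<^sup>5\<close>, and the pentagonal number theorem shows that \<open>f\<^sub>1\<close> has no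
  exponents congruent to 3 or 4 modulo 5. The function \<open>j\<^sub>1\<^sub>0\<^sup>*\<close> reduces to \<open>q\<^sup>-\<^sup>1 g(q\<^sup>4)\<close> with \<open>g = 1 / (f\<^sub>1 f\<^sub>5)\<close>.
  By Jacobi's triple product, \<open>f\<^sub>1 f\<^sub>5\<close> is a product of two theta series; counting representations as
  sums of two odd squares shows that its even part is \<open>\<psi>(q\<^sup>2)\<close>, where \<open>\<psi>\<close> is the generating function of
  the triangular numbers and \<open>\<psi> = f\<^sub>1\<^sup>3\<close>. Hence the even part of \<open>g\<close> is \<open>(f\<^sub>2 / f\<^sub>5)(q\<^sup>2)\<close>, and \<open>f\<^sub>2\<close> has no
  exponents congruent to 1 or 3 modulo 5.\<close>

section \<open>The Jacobi triple product\<close>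

text \<open>The Gaussian binomial coefficient, given by its Pascal recursion instead of a quotient
  of products, so that it makes sense for every \<open>q\<close> in a commutative ring.\<close>

fun qbinom :: "'a::comm_ring_1 \<Rightarrow> nat \<Rightarrow> nat \<Rightarrow> 'a" where
  "qbinom q m 0 = 1"
| "qbinom q 0 (Suc k) = 0"
| "qbinom q (Suc m) (Suc k) = qbinom q m (Suc k) + q ^ (m - k) * qbinom q m k"

lemma qbinom_eq_0: "m < k \<Longrightarrow> qbinom q m k = 0"
  by (induction q m k rule: qbinom.induct) auto

theorem qbinomial_theorem:
  fixes q x y :: "'a::comm_ring_1"
  shows "(\<Prod>j<m. y + x * q ^ j) =
         (\<Sum>k\<le>m. q ^ (k choose 2) * qbinom q m k * x ^ k * y ^ (m - k))"
proof (induction m)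
  case 0
  then show ?case by (simp add: numeral_2_eq_2)
next
  case (Suc m)
  let ?t = "\<lambda>k. q ^ (k choose 2) * qbinom q m k * x ^ k * y ^ (m - k)"
  let ?u = "\<lambda>k. q ^ (k choose 2) * qbinom q m k * x ^ k * y ^ (Suc m - k)"
  have 1: "(\<Sum>k\<le>Suc m. ?u k) = y * (\<Sum>k\<le>m. ?t k)"
    by (simp add: qbinom_eq_0 sum_distrib_left Suc_diff_le mult_ac)
  have 2: "(\<Sum>k\<le>m. q ^ (Suc k choose 2) * (q ^ (m - k) * qbinom q m k) * x ^ Suc k * y ^ (m - k))
      = x * q ^ m * (\<Sum>k\<le>m. ?t k)"
    unfolding sum_distrib_left
  proof (rule sum.cong)
    fix k assume "k \<in> {..m}"
    then have "(Suc k choose 2) + (m - k) = (k choose 2) + m"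
      by (simp add: numeral_2_eq_2)
    then have "q ^ (Suc k choose 2) * q ^ (m - k) = q ^ (k choose 2) * q ^ m"
      by (simp flip: power_add)
    then show "q ^ (Suc k choose 2) * (q ^ (m - k) * qbinom q m k) * x ^ Suc k * y ^ (m - k)
        = x * q ^ m * ?t k"
      by (simp add: mult_ac)
  qed simp
  have "(\<Sum>k\<le>Suc m. q ^ (k choose 2) * qbinom q (Suc m) k * x ^ k * y ^ (Suc m - k))
     = ?u 0 + (\<Sum>k\<le>m. ?u (Suc k)) + (\<Sum>k\<le>m. q ^ (Suc k choose 2) * (q ^ (m - k) * qbinom q m k) * x ^ Suc k * y ^ (m - k))"
    by (subst sum.atMost_Suc_shift) (simp add: sum.distrib algebra_simps)
  also have "?u 0 + (\<Sum>k\<le>m. ?u (Suc k)) = (\<Sum>k\<le>Suc m. ?u k)"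
    by (rule sum.atMost_Suc_shift[symmetric])
  finally show ?case
    unfolding 1 2 prod.lessThan_Suc Suc.IH by (simp only: algebra_simps)
qed

definition qpoch_upto :: "nat \<Rightarrow> nat \<Rightarrow> 'a::comm_ring_1 fps" where
  "qpoch_upto L m = (\<Prod>j\<in>{1..m}. 1 - fps_X ^ (L * j))"

lemma qpoch_upto_0 [simp]: "qpoch_upto L 0 = 1"
  by (simp add: qpoch_upto_def)

lemma qpoch_upto_Suc [simp]:
  "qpoch_upto L (Suc m) = qpoch_upto L m * (1 - fps_X ^ (L * Suc m))"
  by (simp add: qpoch_upto_def)

text \<open>The quotient formula with denominators cleared. In the Pascal recursion both summands
  become multiples of \<open>qpoch_upto L m\<close>; the cofactors \<open>1 - q ^ Suc d\<close> and
  \<open>q ^ Suc d * (1 - q ^ Suc l)\<close> add up to \<open>1 - q ^ Suc m\<close>.\<close>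

lemma qbinom_qpoch_upto:
  "k \<le> m \<Longrightarrow>
   qbinom (fps_X ^ L) m k * qpoch_upto L k * qpoch_upto L (m - k) = (qpoch_upto L m :: 'a::comm_ring_1 fps)"
proof (induction m arbitrary: k)
  case 0
  then show ?case by simp
next
  case (Suc m)
  show ?case
  proof (cases k)
    case 0
    then show ?thesis by simp
  next
    case k: (Suc l)
    show ?thesis
    proof (cases "l = m")
      case True
      then show ?thesis using Suc.IH[of m] k by (simp add: qbinom_eq_0 flip: mult.assoc)
    next
      case False
      then obtain d where d: "m = Suc (l + d)"
        using Suc.prems k by (metis Suc_le_mono le_neq_implies_less less_imp_Suc_add)
      define q where "q = (fps_X :: 'a fps) ^ L"
      have qp: "fps_X ^ (L * j) = q ^ j" for j
        by (simp add: q_def power_mult)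
      have I1: "qbinom q m (Suc l) * qpoch_upto L (Suc l) * qpoch_upto L d = qpoch_upto L m"
        using Suc.IH[of "Suc l"] d by (simp add: q_def)
      have I2: "qbinom q m l * qpoch_upto L l * qpoch_upto L (Suc d) = qpoch_upto L m"
        using Suc.IH[of l] d by (simp add: q_def)
      have S: "qpoch_upto L (Suc j) = qpoch_upto L j * (1 - q ^ Suc j)" for j
        by (simp only: qpoch_upto_Suc qp)
      have "qbinom q (Suc m) k = qbinom q m (Suc l) + q ^ Suc d * qbinom q m l" "Suc m - k = Suc d"
        using k d by (simp_all add: Suc_diff_le)
      then have "qbinom q (Suc m) k * qpoch_upto L k * qpoch_upto L (Suc m - k)
         = (qbinom q m (Suc l) * qpoch_upto L (Suc l) * qpoch_upto L d) * (1 - q ^ Suc d)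
         + q ^ Suc d * (qbinom q m l * qpoch_upto L l * qpoch_upto L (Suc d)) * (1 - q ^ Suc l)"
        unfolding k by (simp only: S algebra_simps)
      also have "\<dots> = qpoch_upto L m * (1 - q ^ Suc d * q ^ Suc l)"
        unfolding I1 I2 by (simp add: algebra_simps del: power_Suc)
      also have "q ^ Suc d * q ^ Suc l = q ^ Suc m"
        unfolding power_add[symmetric] d by (simp add: add_ac)
      finally show ?thesis by (simp only: qpoch_upto_Suc qp q_def[symmetric])
    qed
  qed
qed

text \<open>Exponents on the series side of the triple product. For \<open>L = 3\<close>,
  \<open>a = 1\<close> they are the generalized pentagonal numbers, for \<open>L = 4\<close>,
  \<open>a = 1\<close> the triangular numbers.\<close>

definition theta_exp :: "nat \<Rightarrow> nat \<Rightarrow> int \<Rightarrow> int" where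
  "theta_exp L a i = int L * (i * (i - 1) div 2) + int a * i"

lemma two_theta_exp: "2 * theta_exp L a i = int L * (i * (i - 1)) + 2 * int a * i"
proof -
  have "even (i * (i - 1))" by simp
  then have "2 * (i * (i - 1) div 2) = i * (i - 1)" by (rule dvd_mult_div_cancel)
  then show ?thesis
    unfolding theta_exp_def distrib_left mult.left_commute[of 2 "int L"] by simp
qed

text \<open>This linear growth makes every coefficient of a theta series a finite count and confines
  the indices that matter below a given order.\<close>

lemma abs_le_theta_exp:
  assumes "0 < a" "a < L"
  shows "\<bar>i\<bar> \<le> theta_exp L a i"
proof (cases "i \<ge> 0")
  case True
  have "0 \<le> i * (i - 1)" using True by (cases "i = 0") auto
  then have "0 \<le> int L * (i * (i - 1))" by simp
  moreover have "1 * i \<le> int a * i" using assms True by (intro mult_right_mono) auto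
  ultimately show ?thesis using two_theta_exp[of L a i] True by simp
next
  case False
  define m where "m = - i"
  have m: "m \<ge> 1" "i = - m" using False by (auto simp: m_def)
  have "2 * m \<le> m * (m + 1)" using m by (simp add: mult.commute mult_right_mono)
  then have "int L * (2 * m) \<le> int L * (m * (m + 1))" by (intro mult_left_mono) auto
  moreover have "1 * m \<le> (int L - int a) * m" using assms m by (intro mult_right_mono) auto
  moreover have "2 * theta_exp L a i = int L * (m * (m + 1)) - 2 * (int a * m)"
    unfolding two_theta_exp m(2) by (simp add: algebra_simps)
  ultimately show ?thesis using m by (simp add: left_diff_distrib mult.left_commute[of _ 2])
qed

text \<open>The \<open>q\<close>-binomial theorem for \<open>q = X\<^sup>L\<close>, \<open>x = X\<^sup>a\<close>, \<open>y = q\<^sup>n\<close> with a power of \<open>X\<close> cancelled: taking \<open>y = q\<^sup>n\<close>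
  instead of \<open>x = X\<^sup>a q\<^sup>-\<^sup>n\<close> avoids negative exponents.\<close>
lemma finite_jacobi_triple:
  assumes "0 < a" "a < L"
  shows "(\<Prod>j<n. 1 + fps_X ^ (L * Suc j - a)) * (\<Prod>j<n. 1 + fps_X ^ (L * j + a)) =
    (\<Sum>k\<le>2*n. fps_X ^ nat (theta_exp L a (int k - int n)) * qbinom (fps_X ^ L) (2 * n) k
      :: 'a::comm_ring_1 fps)"
proof -
  \<comment> \<open>The power of \<open>fps_X\<close> to cancel: the \<open>j\<close>-th factor for
    \<open>j < n\<close> gives up \<open>fps_X ^ (L * j + a)\<close>, each of the other
    \<open>n\<close> factors gives up \<open>fps_X ^ (L * n)\<close>.\<close>
  define c where "c = (\<Sum>j<n. L * j + a) + n * (L * n)"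
  have twoc: "2 * int c = int L * (int n * (int n - 1)) + 2 * int a * int n + 2 * int L * int n * int n"
  proof -
    have "2 * int (\<Sum>j<n. L * j + a) = int L * (int n * (int n - 1)) + 2 * int a * int n"
      by (induction n) (auto simp: algebra_simps)
    then show ?thesis by (simp add: c_def)
  qed
  have "(\<Prod>j<2*n. fps_X ^ (L * n) + fps_X ^ a * (fps_X ^ L) ^ j :: 'a fps)
      = (\<Prod>j<n. fps_X ^ (L * n) + fps_X ^ (L * j + a)) * (\<Prod>j<n. fps_X ^ (L * n) + fps_X ^ (L * (n + j) + a))"
  proof -
    have "{..<2*n} = {..<n} \<union> {n..<2*n}" by auto
    moreover have "(\<Prod>j\<in>{n..<2*n}. fps_X ^ (L * n) + fps_X ^ (L * j + a) :: 'a fps)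
        = (\<Prod>j<n. fps_X ^ (L * n) + fps_X ^ (L * (n + j) + a))"
      by (rule prod.reindex_bij_witness[of _ "\<lambda>j. n + j" "\<lambda>j. j - n"]) auto
    ultimately show ?thesis
      by (simp add: prod.union_disjoint ivl_disj_int flip: power_mult power_add add: add.commute)
  qed
  also have "(\<Prod>j<n. fps_X ^ (L * n) + fps_X ^ (L * j + a) :: 'a fps)
      = (\<Prod>j<n. fps_X ^ (L * j + a) * (1 + fps_X ^ (L * Suc (n - Suc j) - a)))"
  proof (rule prod.cong)
    fix j assume "j \<in> {..<n}"
    then obtain d where d: "n = Suc (j + d)" using less_imp_Suc_add by blast
    have "L * n = (L * j + a) + (L * Suc (n - Suc j) - a)"
      using assms d by (simp add: algebra_simps)
    then show "fps_X ^ (L * n) + fps_X ^ (L * j + a) =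
       (fps_X ^ (L * j + a) * (1 + fps_X ^ (L * Suc (n - Suc j) - a)) :: 'a fps)"
      by (simp only: power_add distrib_left mult_1_right add.commute)
  qed simp
  also have "\<dots> = fps_X ^ (\<Sum>j<n. L * j + a) * (\<Prod>j<n. 1 + fps_X ^ (L * Suc j - a))"
    by (simp only: prod.distrib power_sum prod.nat_diff_reindex[of "\<lambda>j. 1 + fps_X ^ (L * Suc j - a)"])
  also have "(\<Prod>j<n. fps_X ^ (L * n) + fps_X ^ (L * (n + j) + a))
      = (fps_X ^ (n * (L * n)) * (\<Prod>j<n. 1 + fps_X ^ (L * j + a)) :: 'a fps)"
  proof -
    have "(\<Prod>j<n. fps_X ^ (L * n) + fps_X ^ (L * (n + j) + a)) =
        (\<Prod>j<n. fps_X ^ (L * n) * (1 + fps_X ^ (L * j + a)) :: 'a fps)"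
      by (simp add: algebra_simps power_add)
    also have "\<dots> = (\<Prod>j<n. fps_X ^ (L * n)) * (\<Prod>j<n. 1 + fps_X ^ (L * j + a))"
      by (rule prod.distrib)
    finally show ?thesis by (simp add: mult.commute flip: power_mult)
  qed
  finally have 1: "(\<Prod>j<2*n. fps_X ^ (L * n) + fps_X ^ a * (fps_X ^ L) ^ j :: 'a fps) =
      fps_X ^ c * ((\<Prod>j<n. 1 + fps_X ^ (L * Suc j - a)) * (\<Prod>j<n. 1 + fps_X ^ (L * j + a)))"
    by (simp add: c_def power_add mult_ac)
  have "(\<Prod>j<2*n. fps_X ^ (L * n) + fps_X ^ a * (fps_X ^ L) ^ j :: 'a fps) =
    (\<Sum>k\<le>2*n. (fps_X ^ L) ^ (k choose 2) * qbinom (fps_X ^ L) (2 * n) k * (fps_X ^ a) ^ k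
      * (fps_X ^ (L * n)) ^ (2 * n - k))"
    by (rule qbinomial_theorem)
  also have "\<dots> = (\<Sum>k\<le>2*n. fps_X ^ c *
     (fps_X ^ nat (theta_exp L a (int k - int n)) * qbinom (fps_X ^ L) (2 * n) k))"
  proof (rule sum.cong)
    fix k assume k: "k \<in> {..2*n}"
    have ch: "2 * int (k choose 2) = int k * (int k - 1)"
      by (induction k) (auto simp: numeral_2_eq_2 algebra_simps)
    have "2 * (int L * int (k choose 2)) = int L * (int k * (int k - 1))"
      unfolding ch[symmetric] by simp
    moreover have "int (L * (k choose 2) + a * k + L * n * (2 * n - k)) =
        int L * int (k choose 2) + int a * int k + int L * int n * (2 * int n - int k)"
      using k by (simp add: of_nat_diff)
    ultimately have "2 * int (L * (k choose 2) + a * k + L * n * (2 * n - k))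
       = 2 * (int c + theta_exp L a (int k - int n))"
      unfolding distrib_left[of 2 "int c"] twoc two_theta_exp by (simp add: algebra_simps)
    moreover have "0 \<le> theta_exp L a (int k - int n)"
      using abs_le_theta_exp[OF assms, of "int k - int n"] by linarith
    moreover have "s = c + nat t" if "2 * int s = 2 * (int c + t)" "0 \<le> t" for s t
      using that by arith
    ultimately have "L * (k choose 2) + a * k + L * n * (2 * n - k) = c + nat (theta_exp L a (int k - int n))"
      by blast
    then have X: "fps_X ^ (L * (k choose 2)) * fps_X ^ (a * k) * fps_X ^ (L * n * (2 * n - k))
       = (fps_X ^ c * fps_X ^ nat (theta_exp L a (int k - int n)) :: 'a fps)"
      by (simp flip: power_add)
    have "(fps_X ^ L) ^ (k choose 2) * qbinom (fps_X ^ L) (2 * n) k * (fps_X ^ a) ^ k * (fps_X ^ (L * n)) ^ (2 * n - k)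
      = (fps_X ^ (L * (k choose 2)) * fps_X ^ (a * k) * fps_X ^ (L * n * (2 * n - k))) * (qbinom (fps_X ^ L) (2 * n) k :: 'a fps)"
      unfolding power_mult[symmetric] by (simp only: mult_ac)
    then show "(fps_X ^ L) ^ (k choose 2) * qbinom (fps_X ^ L) (2 * n) k * (fps_X ^ a) ^ k
      * (fps_X ^ (L * n)) ^ (2 * n - k) = (fps_X ^ c *
     (fps_X ^ nat (theta_exp L a (int k - int n)) * qbinom (fps_X ^ L) (2 * n) k) :: 'a fps)"
      unfolding X unfolding mult.assoc .
  qed simp
  finally have 2: "fps_X ^ c * ((\<Prod>j<n. 1 + fps_X ^ (L * Suc j - a)) * (\<Prod>j<n. 1 + fps_X ^ (L * j + a)))
     = (fps_X ^ c * (\<Sum>k\<le>2*n. fps_X ^ nat (theta_exp L a (int k - int n)) * qbinom (fps_X ^ L) (2 * n) k) :: 'a fps)"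
    unfolding 1 sum_distrib_left .
  have cancel: "f = g" if "fps_X ^ c * f = fps_X ^ c * g" for f g :: "'a fps"
  proof (rule fps_ext)
    fix k
    have "fps_nth (fps_X ^ c * f) (c + k) = fps_nth (fps_X ^ c * g) (c + k)"
      using that by simp
    then show "fps_nth f k = fps_nth g k" by (simp add: fps_X_power_mult_nth)
  qed
  show ?thesis by (rule cancel[OF 2])
qed

section \<open>Truncated equality and the infinite triple product\<close>

text \<open>Congruence modulo \<open>fps_X ^ N\<close>, which replaces convergence in passing from
  finite to infinite products.\<close>

definition fps_agree :: "nat \<Rightarrow> 'a fps \<Rightarrow> 'a fps \<Rightarrow> bool" where
  "fps_agree N f g \<longleftrightarrow> (\<forall>k<N. fps_nth f k = fps_nth g k)"

lemma fps_agree_refl [simp]: "fps_agree N f f"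
  by (simp add: fps_agree_def)

lemma fps_agree_sym: "fps_agree N f g \<Longrightarrow> fps_agree N g f"
  by (simp add: fps_agree_def)

lemma fps_agree_trans [trans]: "fps_agree N f g \<Longrightarrow> fps_agree N g h \<Longrightarrow> fps_agree N f h"
  by (simp add: fps_agree_def)

lemma fps_agree_mult:
  fixes f g :: "'a::semiring_0 fps"
  assumes "fps_agree N f f'" "fps_agree N g g'"
  shows "fps_agree N (f * g) (f' * g')"
  unfolding fps_agree_def
proof (intro allI impI)
  fix n assume "n < N"
  then have "fps_nth f i = fps_nth f' i" "fps_nth g i = fps_nth g' i" if "i \<le> n" for i
    using assms that by (simp_all add: fps_agree_def)
  then show "fps_nth (f * g) n = fps_nth (f' * g') n"
    unfolding fps_mult_nth by (intro sum.cong) simp_all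
qed

lemma fps_agree_sum:
  fixes f :: "'b \<Rightarrow> 'a::comm_monoid_add fps"
  shows "(\<And>i. i \<in> A \<Longrightarrow> fps_agree N (f i) (g i)) \<Longrightarrow> fps_agree N (sum f A) (sum g A)"
  by (simp add: fps_agree_def fps_sum_nth)

lemma fps_eq_if_agree: "(\<And>N. fps_agree N f g) \<Longrightarrow> f = g"
  by (rule fps_ext) (auto simp: fps_agree_def)

text \<open>The series \<open>qpoch\<close> over an arbitrary commutative ring, so that one product
  can be read over the integers, the rationals and the field with two elements.\<close>

definition qpoch_inf :: "nat \<Rightarrow> 'a::comm_ring_1 fps" where
  "qpoch_inf L = Abs_fps (\<lambda>n. fps_nth (qpoch_upto L n) n)"

lemma fps_nth_qpoch_upto:
  assumes "0 < L" "n \<le> m"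
  shows "fps_nth (qpoch_upto L m) n = fps_nth (qpoch_inf L) n"
  using assms(2)
proof (induction m rule: dec_induct)
  case base
  then show ?case by (simp add: qpoch_inf_def)
next
  case (step m)
  have "n < Suc m" using step.hyps by simp
  also have "Suc m \<le> L * Suc m" using mult_le_mono1[of 1 L "Suc m"] assms(1) by simp
  finally have "fps_nth (qpoch_upto L m * fps_X ^ (L * Suc m) :: 'a fps) n = 0"
    by (simp only: fps_X_power_mult_right_nth if_True)
  then show ?case
    using step.IH by (simp only: qpoch_upto_Suc right_diff_distrib mult_1_right fps_sub_nth diff_zero)
qed

lemma fps_agree_qpoch_upto: "0 < L \<Longrightarrow> N \<le> m \<Longrightarrow> fps_agree N (qpoch_upto L m) (qpoch_inf L)"
  by (simp add: fps_agree_def fps_nth_qpoch_upto)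

lemma qpoch_inf_nth_0 [simp]: "fps_nth (qpoch_inf L) 0 = 1"
  by (simp add: qpoch_inf_def)

text \<open>The sum of q to the power \<open>theta_exp L a i\<close> over all integers
  \<open>i\<close>, encoded by counting. For \<open>0 < a\<close> and \<open>a < L\<close> the
  counted sets are finite; \<open>card\<close> would send an infinite set to 0.\<close>

definition theta :: "nat \<Rightarrow> nat \<Rightarrow> 'a::semiring_1 fps" where
  "theta L a = Abs_fps (\<lambda>n. of_nat (card {i. theta_exp L a i = int n}))"

lemma finite_theta_exp:
  assumes "0 < a" "a < L"
  shows "finite {i. theta_exp L a i = n}"
proof (rule finite_subset)
  show "{i. theta_exp L a i = n} \<subseteq> {-n..n}"
  proof
    fix i assume "i \<in> {i. theta_exp L a i = n}"
    then show "i \<in> {-n..n}" using abs_le_theta_exp[OF assms, of i] by auto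
  qed
qed simp

definition jacobi_factor :: "nat \<Rightarrow> nat \<Rightarrow> nat \<Rightarrow> 'a::comm_ring_1 fps" where
  "jacobi_factor L a n = (\<Prod>j<n. 1 + fps_X ^ (L * Suc j - a)) * (\<Prod>j<n. 1 + fps_X ^ (L * j + a))"

lemma fps_agree_theta_sum:
  assumes "0 < a" "a < L" "N \<le> n"
  shows "fps_agree N (\<Sum>k\<le>2*n. fps_X ^ nat (theta_exp L a (int k - int n))) (theta L a :: 'a::comm_ring_1 fps)"
  unfolding fps_agree_def
proof (intro allI impI)
  fix m assume m: "m < N"
  have nonneg: "0 \<le> theta_exp L a i" for i
    using abs_le_theta_exp[OF assms(1,2), of i] by linarith
  have "fps_nth (\<Sum>k\<le>2*n. fps_X ^ nat (theta_exp L a (int k - int n)) :: 'a fps) m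
      = (\<Sum>k\<le>2*n. if theta_exp L a (int k - int n) = int m then 1 else 0)"
    unfolding fps_sum_nth by (rule sum.cong) (use nonneg in \<open>auto simp: nat_eq_iff\<close>)
  also have "\<dots> = of_nat (card {k\<in>{..2*n}. theta_exp L a (int k - int n) = int m})"
    by (simp add: sum.If_cases Int_def)
  also have "card {k\<in>{..2*n}. theta_exp L a (int k - int n) = int m} = card {i. theta_exp L a i = int m}"
  proof (rule bij_betw_same_card[of "\<lambda>k. int k - int n"], rule bij_betwI[where g = "\<lambda>i. nat (i + int n)"])
    show "(\<lambda>i. nat (i + int n)) \<in> {i. theta_exp L a i = int m} \<rightarrow>
        {k\<in>{..2*n}. theta_exp L a (int k - int n) = int m}"
    proof
      fix i assume "i \<in> {i. theta_exp L a i = int m}"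
      moreover from this have "\<bar>i\<bar> \<le> int n"
        using abs_le_theta_exp[OF assms(1,2), of i] m assms(3) by simp
      ultimately show "nat (i + int n) \<in> {k\<in>{..2*n}. theta_exp L a (int k - int n) = int m}"
        by (auto simp: nat_le_iff)
    qed
    show "int (nat (i + int n)) - int n = i" if "i \<in> {i. theta_exp L a i = int m}" for i
      using that abs_le_theta_exp[OF assms(1,2), of i] m assms(3) by simp
  qed auto
  finally show "fps_nth (\<Sum>k\<le>2*n. fps_X ^ nat (theta_exp L a (int k - int n)) :: 'a fps) m
      = fps_nth (theta L a) m"
    by (simp add: theta_def)
qed

text \<open>In the finite identity a Gaussian binomial times \<open>qpoch_inf L\<close> is 1 up to
  order \<open>N\<close> once \<open>k\<close> and \<open>2 * n - k\<close> are at least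
  \<open>N\<close>; \<open>2 * N \<le> n\<close> ensures this for all \<open>k\<close> within
  \<open>N\<close> of \<open>n\<close>. The other terms start beyond order \<open>N\<close>.\<close>

theorem jacobi_triple_product:
  assumes "0 < a" "a < L" "2 * N \<le> n"
  shows "fps_agree N (jacobi_factor L a n * qpoch_inf L) (theta L a :: 'a::field fps)"
proof -
  have "0 < L" using assms by simp
  let ?P = "qpoch_inf L :: 'a fps"
  let ?e = "\<lambda>k. nat (theta_exp L a (int k - int n))"
  have "fps_agree N (fps_X ^ ?e k * qbinom (fps_X ^ L) (2 * n) k * ?P) (fps_X ^ ?e k)" if k: "k \<le> 2 * n" for k
  proof (cases "\<bar>int k - int n\<bar> \<le> int N")
    case True
    then have le: "N \<le> k" "N \<le> 2 * n - k" "N \<le> 2 * n" using assms(3) by auto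
    have "fps_agree N (qbinom (fps_X ^ L) (2 * n) k * ?P * ?P)
        (qbinom (fps_X ^ L) (2 * n) k * qpoch_upto L k * qpoch_upto L (2 * n - k))"
      by (intro fps_agree_mult fps_agree_refl fps_agree_sym[OF fps_agree_qpoch_upto] \<open>0 < L\<close> le)
    also have "qbinom (fps_X ^ L) (2 * n) k * qpoch_upto L k * qpoch_upto L (2 * n - k) = (qpoch_upto L (2 * n) :: 'a fps)"
      by (rule qbinom_qpoch_upto[OF k])
    also have "fps_agree N (qpoch_upto L (2 * n)) ?P"
      by (rule fps_agree_qpoch_upto[OF \<open>0 < L\<close> le(3)])
    finally have "fps_agree N (qbinom (fps_X ^ L) (2 * n) k * ?P * ?P * inverse ?P) (?P * inverse ?P)"
      by (rule fps_agree_mult) simp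
    then have "fps_agree N (qbinom (fps_X ^ L) (2 * n) k * ?P) 1"
      by (simp add: inverse_mult_eq_1' mult.assoc)
    then have "fps_agree N (fps_X ^ ?e k * (qbinom (fps_X ^ L) (2 * n) k * ?P)) (fps_X ^ ?e k * 1)"
      by (intro fps_agree_mult) auto
    then show ?thesis by (simp add: mult.assoc)
  next
    case False
    then have "N < ?e k" using abs_le_theta_exp[OF assms(1,2), of "int k - int n"] by linarith
    then show ?thesis
      by (simp add: fps_agree_def mult.assoc fps_X_power_mult_nth)
  qed
  then have "fps_agree N (\<Sum>k\<le>2*n. fps_X ^ ?e k * qbinom (fps_X ^ L) (2 * n) k * ?P) (\<Sum>k\<le>2*n. fps_X ^ ?e k)"
    by (intro fps_agree_sum) auto
  also have "fps_agree N \<dots> (theta L a)"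
    by (rule fps_agree_theta_sum) (use assms in auto)
  finally show ?thesis
    unfolding jacobi_factor_def finite_jacobi_triple[OF assms(1,2)] sum_distrib_right .
qed

text \<open>The simpset of \<open>Z2\<close> rewrites field operations to bit operations, which breaks ring reasoning.\<close>
declare add_bit_eq_xor [simp del] mult_bit_eq_and [simp del] minus_bit_def [simp del]
  uminus_bit_def [simp del] divide_bit_def [simp del] inverse_bit_def [simp del]

section \<open>Product identities over the field with two elements\<close>

lemma bit_fps_two_eq_0: "(2 :: bit fps) = 0"
  by (metis bit_2_eq_0 fps_const_0_eq_0 numeral_fps_const)

lemma bit_fps_add_self: "x + x = (0 :: bit fps)"
  by (metis bit_fps_two_eq_0 mult_2 mult_zero_left)

lemma bit_fps_diff_eq_add: "x - y = (x + y :: bit fps)"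
  by (simp only: diff_conv_add_uminus minus_unique[OF bit_fps_add_self])

lemma qpoch_upto_bit: "qpoch_upto L m = (\<Prod>j\<in>{1..m}. 1 + fps_X ^ (L * j) :: bit fps)"
  by (simp add: qpoch_upto_def bit_fps_diff_eq_add)

lemma jacobi_factor_Suc:
  "jacobi_factor L a (Suc n) =
   jacobi_factor L a n * ((1 + fps_X ^ (L * Suc n - a)) * (1 + fps_X ^ (L * n + a)))"
  by (simp add: jacobi_factor_def mult_ac)

lemma jacobi_factor_0 [simp]: "jacobi_factor L a 0 = 1"
  by (simp add: jacobi_factor_def)

text \<open>Euler's pentagonal number theorem without signs: the exponents 1 and 2 modulo 3 from the
  Jacobi factor and the multiples of 3 from \<open>qpoch_upto 3\<close> exhaust the positive
  integers.\<close>

lemma qpoch_inf_1_eq_theta: "qpoch_inf 1 = (theta 3 1 :: bit fps)"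
proof (rule fps_eq_if_agree)
  fix N :: nat
  let ?n = "2 * N"
  have fin: "jacobi_factor 3 1 n * qpoch_upto 3 n = (qpoch_upto 1 (3 * n) :: bit fps)" for n
  proof (induction n)
    case (Suc n)
    have "3 * Suc n = Suc (Suc (Suc (3 * n)))" "\<And>m. Suc 0 * m = m" by simp_all
    then show ?case
      by (simp only: jacobi_factor_Suc Suc.IH[symmetric, unfolded One_nat_def] qpoch_upto_Suc bit_fps_diff_eq_add One_nat_def add_Suc_right add_0_right diff_Suc_Suc minus_nat.diff_0) (simp only: mult_ac)
  qed simp
  have "fps_agree N (qpoch_inf 1) (qpoch_upto 1 (3 * ?n))"
    by (rule fps_agree_sym, rule fps_agree_qpoch_upto) auto
  also have "qpoch_upto 1 (3 * ?n) = (jacobi_factor 3 1 ?n * qpoch_upto 3 ?n :: bit fps)"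
    by (rule fin[symmetric])
  also have "fps_agree N \<dots> (jacobi_factor 3 1 ?n * qpoch_inf 3)"
    by (intro fps_agree_mult fps_agree_refl fps_agree_qpoch_upto) auto
  also have "fps_agree N \<dots> (theta 3 1)"
    by (rule jacobi_triple_product) auto
  finally show "fps_agree N (qpoch_inf 1) (theta 3 1 :: bit fps)" .
qed

text \<open>The two Jacobi factors cover the residues 1, 4 and 2, 3 modulo 5, so one copy of
  \<open>qpoch_inf 5\<close> completes \<open>qpoch_inf 1\<close>; the second copy is what the other
  theta series requires.\<close>

lemma qpoch_inf_1_5_eq_theta: "qpoch_inf 1 * qpoch_inf 5 = (theta 5 1 * theta 5 2 :: bit fps)"
proof (rule fps_eq_if_agree)
  fix N :: nat
  let ?n = "2 * N"
  have fin: "jacobi_factor 5 1 n * jacobi_factor 5 2 n * qpoch_upto 5 n = (qpoch_upto 1 (5 * n) :: bit fps)" for n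
  proof (induction n)
    case (Suc n)
    have "5 * Suc n = Suc (Suc (Suc (Suc (Suc (5 * n)))))" "\<And>m. Suc 0 * m = m" by simp_all
    then show ?case
      by (simp only: jacobi_factor_Suc Suc.IH[symmetric, unfolded One_nat_def] qpoch_upto_Suc bit_fps_diff_eq_add One_nat_def add_Suc_right add_0_right diff_Suc_Suc minus_nat.diff_0 numeral_2_eq_2) (simp only: mult_ac)
  qed simp
  have "fps_agree N (qpoch_inf 1 * qpoch_inf 5) (qpoch_upto 1 (5 * ?n) * qpoch_inf 5)"
    by (rule fps_agree_sym, intro fps_agree_mult fps_agree_refl fps_agree_qpoch_upto) auto
  also have "qpoch_upto 1 (5 * ?n) * qpoch_inf 5
     = (jacobi_factor 5 1 ?n * qpoch_upto 5 ?n * (jacobi_factor 5 2 ?n * qpoch_inf 5) :: bit fps)"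
    unfolding fin[symmetric] by (simp only: mult_ac)
  also have "fps_agree N \<dots> (jacobi_factor 5 1 ?n * qpoch_inf 5 * (jacobi_factor 5 2 ?n * qpoch_inf 5))"
    by (intro fps_agree_mult fps_agree_refl fps_agree_qpoch_upto) auto
  also have "fps_agree N \<dots> (theta 5 1 * theta 5 2)"
    by (intro fps_agree_mult jacobi_triple_product) auto
  finally show "fps_agree N (qpoch_inf 1 * qpoch_inf 5) (theta 5 1 * theta 5 2 :: bit fps)" .
qed

text \<open>The Jacobi factor runs over the odd exponents, so in the limit it is
  \<open>qpoch_inf 1 / qpoch_inf 2\<close>; the denominator is moved to the other side.\<close>

lemma theta_4_1: "theta 4 1 * qpoch_inf 2 = (qpoch_inf 1 * qpoch_inf 4 :: bit fps)"
proof (rule fps_eq_if_agree)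
  fix N :: nat
  let ?n = "2 * N"
  have fin: "jacobi_factor 4 1 n * qpoch_upto 2 (2 * n) = (qpoch_upto 1 (4 * n) :: bit fps)" for n
  proof (induction n)
    case (Suc n)
    have "4 * Suc n = Suc (Suc (Suc (Suc (4 * n))))" "2 * Suc n = Suc (Suc (2 * n))" "2 * Suc (2 * n) = Suc (Suc (4 * n))" "2 * Suc (Suc (2 * n)) = Suc (Suc (Suc (Suc (4 * n))))"
      "\<And>m. Suc 0 * m = m" by simp_all
    then show ?case
      by (simp only: jacobi_factor_Suc Suc.IH[symmetric, unfolded One_nat_def] qpoch_upto_Suc bit_fps_diff_eq_add One_nat_def add_Suc_right add_0_right diff_Suc_Suc minus_nat.diff_0) (simp only: mult_ac)
  qed simp
  have "fps_agree N (qpoch_inf 1 * qpoch_inf 4) (qpoch_upto 1 (4 * ?n) * qpoch_inf 4)"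
    by (rule fps_agree_sym, intro fps_agree_mult fps_agree_refl fps_agree_qpoch_upto) auto
  also have "qpoch_upto 1 (4 * ?n) * qpoch_inf 4
     = (jacobi_factor 4 1 ?n * qpoch_inf 4 * qpoch_upto 2 (2 * ?n) :: bit fps)"
    unfolding fin[symmetric] by (simp only: mult_ac)
  also have "fps_agree N \<dots> (theta 4 1 * qpoch_inf 2)"
    by (intro fps_agree_mult fps_agree_qpoch_upto jacobi_triple_product) auto
  finally show "fps_agree N (theta 4 1 * qpoch_inf 2) (qpoch_inf 1 * qpoch_inf 4 :: bit fps)"
    by (rule fps_agree_sym)
qed

lemma qpoch_inf_double: "qpoch_inf (2 * L) = (qpoch_inf L ^ 2 :: bit fps)" if "0 < L"
proof (rule fps_eq_if_agree)
  fix N :: nat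
  have sq: "(1 + x) ^ 2 = 1 + x ^ 2" for x :: "bit fps"
    by (simp only: power2_sum bit_fps_two_eq_0 mult_zero_left add_0_right power_one)
  have "fps_agree N (qpoch_inf (2 * L)) (qpoch_upto (2 * L) N)"
    by (rule fps_agree_sym, rule fps_agree_qpoch_upto) (use that in auto)
  also have "qpoch_upto (2 * L) N = (qpoch_upto L N ^ 2 :: bit fps)"
    unfolding qpoch_upto_bit prod_power_distrib sq by (simp add: mult_ac flip: power_mult)
  also have "fps_agree N \<dots> (qpoch_inf L ^ 2)"
    unfolding power2_eq_square by (intro fps_agree_mult fps_agree_qpoch_upto) (use that in auto)
  finally show "fps_agree N (qpoch_inf (2 * L)) (qpoch_inf L ^ 2 :: bit fps)" .
qed

lemma qpoch_inf_compose:
  assumes "0 < d" "0 < L"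
  shows "qpoch_inf (d * L) = (qpoch_inf L oo fps_X ^ d :: 'a::idom fps)"
proof (rule fps_eq_if_agree)
  fix N :: nat
  have "fps_agree N (qpoch_inf (d * L)) (qpoch_upto (d * L) N)"
    by (rule fps_agree_sym, rule fps_agree_qpoch_upto) (use assms in auto)
  also have "qpoch_upto (d * L) N = (qpoch_upto L N oo fps_X ^ d :: 'a fps)"
  proof (induction N)
    case (Suc N)
    have c0: "fps_nth (fps_X ^ d :: 'a fps) 0 = 0" using assms by simp
    have "fps_X ^ (L * k) oo fps_X ^ d = (fps_X ^ (d * L * k) :: 'a fps)" for k
      unfolding fps_compose_power[OF c0, symmetric] fps_X_fps_compose_startby0[OF c0]
      by (simp only: power_mult[symmetric] mult.assoc)
    then show ?case
      by (simp only: qpoch_upto_Suc fps_compose_mult_distrib[OF c0] fps_compose_sub_distrib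
          fps_compose_1 Suc.IH)
  qed simp
  also have "fps_agree N \<dots> (qpoch_inf L oo fps_X ^ d)"
    unfolding fps_agree_def
  proof (intro allI impI)
    fix k assume "k < N"
    then have "k div d \<le> N" by (meson div_le_dividend le_trans less_imp_le)
    then show "fps_nth (qpoch_upto L N oo fps_X ^ d :: 'a fps) k = fps_nth (qpoch_inf L oo fps_X ^ d) k"
      using assms by (simp add: fps_nth_compose_X_power fps_nth_qpoch_upto)
  qed
  finally show "fps_agree N (qpoch_inf (d * L)) (qpoch_inf L oo fps_X ^ d :: 'a fps)" .
qed

section \<open>Sums of two odd squares\<close>

lemma fps_nth_theta_mult:
  assumes "0 < a" "a < L" "0 < b" "b < L"
  shows "fps_nth (theta L a * theta L b) n =
         (of_nat (card {(i, j). theta_exp L a i + theta_exp L b j = int n}) :: 'a::semiring_1)"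
proof -
  let ?A = "\<lambda>k. {i. theta_exp L a i = int k}" and ?B = "\<lambda>k. {j. theta_exp L b j = int k}"
  have "{(i, j). theta_exp L a i + theta_exp L b j = int n} = (\<Union>k\<in>{0..n}. ?A k \<times> ?B (n - k))"
  proof (intro equalityI subsetI)
    fix p assume "p \<in> {(i, j). theta_exp L a i + theta_exp L b j = int n}"
    then obtain i j where p: "p = (i, j)" "theta_exp L a i + theta_exp L b j = int n" by auto
    moreover have "0 \<le> theta_exp L a i" "0 \<le> theta_exp L b j"
      using abs_le_theta_exp[OF assms(1,2), of i] abs_le_theta_exp[OF assms(3,4), of j] by linarith+
    ultimately have "nat (theta_exp L a i) \<in> {0..n}" "p \<in> ?A (nat (theta_exp L a i)) \<times> ?B (n - nat (theta_exp L a i))"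
      by auto
    then show "p \<in> (\<Union>k\<in>{0..n}. ?A k \<times> ?B (n - k))" by blast
  qed auto
  moreover have "card (\<Union>k\<in>{0..n}. ?A k \<times> ?B (n - k)) = (\<Sum>k\<in>{0..n}. card (?A k) * card (?B (n - k)))"
    using assms by (subst card_UN_disjoint) (auto simp: finite_theta_exp card_cartesian_product)
  ultimately show ?thesis by (simp add: fps_mult_nth theta_def)
qed

text \<open>The factor \<open>d\<close> avoids dividing \<open>K\<close>: with \<open>d = 5\<close>
  the set is simply empty unless 5 divides \<open>K\<close>.\<close>

definition odd_reps :: "int \<Rightarrow> int \<Rightarrow> (int \<times> int) set" where
  "odd_reps d K = {(u, v). odd u \<and> odd v \<and> d * (u\<^sup>2 + v\<^sup>2) = K}"

lemma finite_odd_reps: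
  assumes "0 < d"
  shows "finite (odd_reps d K)"
proof (rule finite_subset)
  show "odd_reps d K \<subseteq> {-K..K} \<times> {-K..K}"
  proof
    fix p assume "p \<in> odd_reps d K"
    then obtain u v where p: "p = (u, v)" "d * (u\<^sup>2 + v\<^sup>2) = K" by (auto simp: odd_reps_def)
    have sq: "\<bar>z\<bar> \<le> z\<^sup>2" for z :: int
      using self_le_power[of "\<bar>z\<bar>" 2] by (cases "z = 0") auto
    have "u\<^sup>2 + v\<^sup>2 \<le> K"
      using mult_right_mono[of 1 d "u\<^sup>2 + v\<^sup>2"] assms p by simp
    then have "\<bar>u\<bar> \<le> K" "\<bar>v\<bar> \<le> K" using sq[of u] sq[of v] by auto
    then show "p \<in> {-K..K} \<times> {-K..K}" using p by auto
  qed
qed simp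

text \<open>The quarter turn \<open>(u, v) \<mapsto> (-v, u)\<close> preserves the representations.
  It serves twice, for quadrants and for residues modulo 5.\<close>

lemma card_odd_reps_rotate:
  "card {(u, v). (u, v) \<in> odd_reps d K \<and> P (-v) u} = card {(u, v). (u, v) \<in> odd_reps d K \<and> P u v}"
  by (rule bij_betw_same_card[of "\<lambda>(u, v). (-v, u)"],
      rule bij_betw_byWitness[where f' = "\<lambda>(u, v). (v, -u)"]) (auto simp: odd_reps_def add.commute)

definition pos_odd_reps :: "int \<Rightarrow> int \<Rightarrow> (int \<times> int) set" where
  "pos_odd_reps d K = {(u, v). (u, v) \<in> odd_reps d K \<and> 0 < u \<and> 0 < v}"

lemma card_pairs_by_value:
  assumes "finite A" "finite C" "\<And>u v. (u, v) \<in> A \<Longrightarrow> h u v \<in> C"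
  shows "card A = (\<Sum>c\<in>C. card {(u, v). (u, v) \<in> A \<and> h u v = c})"
proof -
  have "case_prod h ` A \<subseteq> C" using assms(3) by auto
  then have "card A = (\<Sum>c\<in>C. card {p \<in> A. case_prod h p = c})"
    using sum.group[OF assms(1,2), of "case_prod h" "\<lambda>_. 1 :: nat"] by simp
  moreover have "{p \<in> A. case_prod h p = c} = {(u, v). (u, v) \<in> A \<and> h u v = c}" for c
    by auto
  ultimately show ?thesis by simp
qed

text \<open>The quarter turn permutes the four open quadrants cyclically, and no odd coordinate is
  0.\<close>

lemma card_odd_reps:
  assumes "0 < d"
  shows "card (odd_reps d K) = 4 * card (pos_odd_reps d K)"
proof -
  let ?R = "\<lambda>c. {(u, v). (u, v) \<in> odd_reps d K \<and> (0 < u, 0 < v) = c}"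
  have rot: "card (?R (b, c)) = card (?R (c, \<not> b))" for b c
  proof -
    have "card (?R (b, c)) = card {(u, v). (u, v) \<in> odd_reps d K \<and> (0 < - v, 0 < u) = (b, c)}"
      by (rule card_odd_reps_rotate[symmetric])
    also have "{(u, v). (u, v) \<in> odd_reps d K \<and> (0 < - v, 0 < u) = (b, c)} = ?R (c, \<not> b)"
    proof -
      have "0 < - v \<longleftrightarrow> \<not> 0 < v" if "(u, v) \<in> odd_reps d K" for u v
        using that by (cases "v = 0") (auto simp: odd_reps_def)
      then show ?thesis by auto
    qed
    finally show ?thesis .
  qed
  have "card (odd_reps d K) = (\<Sum>c\<in>{(True, True), (True, False), (False, False), (False, True)}. card (?R c))"
    by (rule card_pairs_by_value[OF finite_odd_reps[OF assms]]) auto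
  also have "\<dots> = card (?R (True, True)) + (card (?R (True, False)) + (card (?R (False, False)) + card (?R (False, True))))"
    by (subst sum.insert; (simp only: finite.intros)?; (simp only: insert_iff prod.inject empty_iff simp_thms)?)+ simp
  also have "\<dots> = 4 * card (?R (True, True))"
    using rot[of True True] rot[of True False] rot[of False False]
    by (simp only: not_True_eq_False not_False_eq_True)
  also have "?R (True, True) = pos_odd_reps d K"
    by (auto simp: pos_odd_reps_def)
  finally show ?thesis .
qed

text \<open>Swapping the coordinates pairs off the points away from the diagonal, and positivity
  leaves at most one point on it.\<close>

lemma odd_card_pos_odd_reps:
  assumes "0 < d"
  shows "odd (card (pos_odd_reps d K)) \<longleftrightarrow> (\<exists>z. 0 < z \<and> odd z \<and> d * (2 * z\<^sup>2) = K)"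
proof -
  let ?R = "\<lambda>c. {(u, v). (u, v) \<in> pos_odd_reps d K \<and> sgn (v - u) = c}"
  let ?D = "{(u, v). (u, v) \<in> pos_odd_reps d K \<and> u = v}"
  have "finite (pos_odd_reps d K)"
    by (rule finite_subset[OF _ finite_odd_reps[OF assms, of K]]) (auto simp: pos_odd_reps_def)
  then have "card (pos_odd_reps d K) = (\<Sum>c\<in>{1, -1, 0}. card (?R c))"
    by (rule card_pairs_by_value) (auto simp: sgn_if)
  also have "\<dots> = card (?R 1) + (card (?R (-1)) + card (?R 0))"
    by simp
  also have "card (?R 1) = card (?R (-1))"
    by (rule bij_betw_same_card[of prod.swap], rule bij_betw_byWitness[where f' = prod.swap])
       (auto simp: pos_odd_reps_def odd_reps_def add.commute sgn_if split: if_splits)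
  also have "?R 0 = ?D"
    by (auto simp: sgn_eq_0_iff)
  finally have "card (pos_odd_reps d K) = 2 * card (?R (-1)) + card ?D"
    by simp
  then have 1: "odd (card (pos_odd_reps d K)) \<longleftrightarrow> odd (card ?D)"
    by simp
  show ?thesis
  proof (cases "\<exists>z. 0 < z \<and> odd z \<and> d * (2 * z\<^sup>2) = K")
    case True
    then obtain z where z: "0 < z" "odd z" "d * (2 * z\<^sup>2) = K" by blast
    have "p = (z, z)" if p: "p \<in> ?D" for p
    proof -
      obtain u where u: "p = (u, u)" "(u, u) \<in> pos_odd_reps d K" using p by (cases p) simp
      then have "0 < u" "d * (2 * u\<^sup>2) = K" by (simp_all add: pos_odd_reps_def odd_reps_def)
      then have "d * (2 * u\<^sup>2) = d * (2 * z\<^sup>2)" using z(3) by metis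
      then have "u\<^sup>2 = z\<^sup>2" using assms by simp
      then have "u = z" using \<open>0 < u\<close> z(1) by (simp add: power2_eq_iff_nonneg)
      then show ?thesis using u(1) by simp
    qed
    moreover have "(z, z) \<in> ?D"
      using z by (simp add: pos_odd_reps_def odd_reps_def)
    ultimately have "?D = {(z, z)}" by blast
    then have "card ?D = 1" by simp
    then show ?thesis using True by (simp only: 1 odd_one simp_thms)
  next
    case False
    have "p \<notin> ?D" for p
    proof
      assume "p \<in> ?D"
      then obtain u where "(u, u) \<in> pos_odd_reps d K" by (cases p) simp
      then have "0 < u" "odd u" "d * (2 * u\<^sup>2) = K"
        by (simp_all add: pos_odd_reps_def odd_reps_def)
      then show False using False by metis
    qed
    then have "?D = {}" by blast
    then show ?thesis using False by (simp only: 1 card.empty even_zero simp_thms)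
  qed
qed

lemma odd_square_eq:
  fixes z :: int
  assumes "odd z"
  obtains t where "z\<^sup>2 = 8 * t + 1"
proof -
  from assms obtain w where w: "z = 2 * w + 1" by (rule oddE)
  have "even (w * (w + 1))" by simp
  then obtain t where "w * (w + 1) = 2 * t" by (rule evenE)
  then have "z\<^sup>2 = 8 * t + 1"
    unfolding w by (simp add: power2_eq_square algebra_simps)
  then show ?thesis by (rule that)
qed

text \<open>With \<open>a = 10 * i - 3\<close> and \<open>b = 10 * j - 1\<close>, completing squares
  gives \<open>a\<^sup>2 + b\<^sup>2 = 5 * (8 * int N + 2)\<close>. Dividing the Gaussian integer
  with parts \<open>a\<close>, \<open>b\<close> by 2 - sqrt(-1) removes the 5 and yields
  \<open>u = (2 * a - b) div 5\<close>, \<open>v = (a + 2 * b) div 5\<close>, for which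
  \<open>u - 2 * v = - b\<close>.\<close>

lemma card_theta_5:
  "card {(i, j). theta_exp 5 1 i + theta_exp 5 2 j = int N} =
   card {(u, v). (u, v) \<in> odd_reps 1 (8 * int N + 2) \<and> (u - 2 * v) mod 5 = 1}"
proof -
  let ?f = "\<lambda>(i, j). (4 * i - 2 * j - 1, 2 * i + 4 * j - 1) :: int \<times> int"
  let ?g = "\<lambda>(u, v). ((2 * u + v + 3) div 10, (1 - u + 2 * v) div 10) :: int \<times> int"
  let ?A = "{(i, j). theta_exp 5 1 i + theta_exp 5 2 j = int N}"
  let ?B = "{(u, v). (u, v) \<in> odd_reps 1 (8 * int N + 2) \<and> (u - 2 * v) mod 5 = 1}"
  have sum: "8 * (theta_exp 5 1 i + theta_exp 5 2 j) + 2 = (4 * i - 2 * j - 1)\<^sup>2 + (2 * i + 4 * j - 1)\<^sup>2" for i j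
    using two_theta_exp[of 5 1 i] two_theta_exp[of 5 2 j] by (simp add: power2_eq_square algebra_simps)
  \<comment> \<open>The divisions by 10 in \<open>?g\<close> are exact: the residue condition
    supplies the factor 5, oddness of \<open>u\<close> and \<open>v\<close> the factor 2.\<close>
  have inv: "?f (?g (u, v)) = (u, v)" if "odd u" "odd v" "(u - 2 * v) mod 5 = 1" for u v
  proof -
    define w where "w = (u - 2 * v) div 5"
    have u: "u = 2 * v + 1 + 5 * w"
      using mult_div_mod_eq[of 5 "u - 2 * v"] that(3) by (simp add: w_def)
    then have "even w" using that(1) by simp
    then obtain t where t: "w = 2 * t" by (rule evenE)
    from that(2) obtain s where s: "v = 2 * s + 1" by (rule oddE)
    have "2 * u + v + 3 = 10 * (s + 1 + 2 * t)" "1 - u + 2 * v = 10 * (- t)"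
      unfolding u t s by simp_all
    then have "?g (u, v) = (s + 1 + 2 * t, - t)"
      by (simp only: prod.case) simp
    then show ?thesis by (simp add: u t s)
  qed
  have "?g (?f (i, j)) = (i, j)" for i j
  proof -
    have "2 * (4 * i - 2 * j - 1) + (2 * i + 4 * j - 1) + 3 = 10 * i"
      "1 - (4 * i - 2 * j - 1) + 2 * (2 * i + 4 * j - 1) = 10 * j" by simp_all
    then show ?thesis by (simp only: prod.case) simp
  qed
  then have gf: "\<forall>p\<in>?A. ?g (?f p) = p" by blast
  have fg: "\<forall>q\<in>?B. ?f (?g q) = q"
    using inv unfolding odd_reps_def by blast
  have fA: "?f ` ?A \<subseteq> ?B"
  proof
    fix q assume "q \<in> ?f ` ?A"
    then obtain i j where ij: "q = ?f (i, j)" "theta_exp 5 1 i + theta_exp 5 2 j = int N" by auto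
    have "8 * int N + 2 = (4 * i - 2 * j - 1)\<^sup>2 + (2 * i + 4 * j - 1)\<^sup>2"
      using sum[of i j] unfolding ij(2) .
    moreover have "(4 * i - 2 * j - 1 - 2 * (2 * i + 4 * j - 1)) mod 5 = 1" by presburger
    ultimately show "q \<in> ?B"
      unfolding ij(1) by (simp add: odd_reps_def)
  qed
  have gB: "?g ` ?B \<subseteq> ?A"
  proof
    fix p assume "p \<in> ?g ` ?B"
    then obtain u v where uv: "p = ?g (u, v)" "(u, v) \<in> ?B" by auto
    define i j where "i = (2 * u + v + 3) div 10" and "j = (1 - u + 2 * v) div 10"
    have "(4 * i - 2 * j - 1, 2 * i + 4 * j - 1) = (u, v)"
      using inv[of u v] uv by (simp add: odd_reps_def i_def j_def)
    then have "8 * (theta_exp 5 1 i + theta_exp 5 2 j) + 2 = u\<^sup>2 + v\<^sup>2"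
      unfolding sum by simp
    then show "p \<in> ?A" using uv by (simp add: odd_reps_def i_def j_def)
  qed
  show ?thesis
    by (rule bij_betw_same_card[OF bij_betw_byWitness[OF gf fg fA gB]])
qed

text \<open>The map \<open>(u, v) \<mapsto> (-v, u)\<close> multiplies \<open>u - 2v\<close> by \<open>-2\<close> modulo 5, so the four nonzero
  residue classes of \<open>u - 2v\<close> are equally frequent.\<close>
lemma card_odd_reps_mod_5:
  "card (odd_reps 1 K) = card (odd_reps 5 K)
     + 4 * card {(u, v). (u, v) \<in> odd_reps 1 K \<and> (u - 2 * v) mod 5 = 1}"
proof -
  let ?R = "\<lambda>c. {(u, v). (u, v) \<in> odd_reps 1 K \<and> (u - 2 * v) mod 5 = c}"
  have residue: "x mod 5 \<in> {0, 1, 2, 3, 4}" for x :: int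
  proof -
    have "x mod 5 = 0 \<or> x mod 5 = 1 \<or> x mod 5 = 2 \<or> x mod 5 = 3 \<or> x mod 5 = 4"
      by presburger
    then show ?thesis by simp
  qed
  have rot: "card (?R c) = card (?R c')"
    if c: "\<And>r :: int. r \<in> {0, 1, 2, 3, 4} \<Longrightarrow> 3 * r mod 5 = c' \<longleftrightarrow> r = c" for c c'
  proof -
    have "- v - 2 * u = 3 * (u - 2 * v) + 5 * (v - u)" for u v :: int by simp
    then have "(- v - 2 * u) mod 5 = 3 * ((u - 2 * v) mod 5) mod 5" for u v :: int
      by (simp only: mod_mult_self2 mod_mult_right_eq)
    then have "(- v - 2 * u) mod 5 = c' \<longleftrightarrow> (u - 2 * v) mod 5 = c" for u v :: int
      by (simp only: c[OF residue])
    then show ?thesis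
      using card_odd_reps_rotate[of 1 K "\<lambda>u v. (u - 2 * v) mod 5 = c'"] by simp
  qed
  have "card (odd_reps 1 K) = (\<Sum>c\<in>{0, 1, 2, 3, 4}. card (?R c))"
    by (rule card_pairs_by_value) (simp_all only: finite_odd_reps residue zero_less_one finite.intros)
  also have "\<dots> = card (?R 0) + (card (?R 1) + (card (?R 2) + (card (?R 3) + card (?R 4))))"
    by simp
  also have "card (?R 3) = card (?R 4)" by (rule rot) auto
  also have "card (?R 4) = card (?R 2)" by (rule rot) auto
  also have "card (?R 2) = card (?R 1)" by (rule rot) auto
  \<comment> \<open>\<open>u - 2 * v\<close> is divisible by 5 exactly when the Gaussian integer
    with parts \<open>u\<close>, \<open>v\<close> is divisible by 2 + sqrt(-1). The conjugate of the
    quotient has parts \<open>x\<close>, \<open>y\<close>: the norm drops by the factor 5 and the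
    parts stay odd.\<close>
  also have "card (?R 0) = card (odd_reps 5 K)"
  proof -
    let ?f = "\<lambda>(x, y). (2 * x + y, x - 2 * y) :: int \<times> int"
    let ?g = "\<lambda>(u, v). ((2 * u + v) div 5, (u - 2 * v) div 5) :: int \<times> int"
    have sum: "(2 * x + y)\<^sup>2 + (x - 2 * y)\<^sup>2 = 5 * (x\<^sup>2 + y\<^sup>2)" for x y :: int
      by (simp add: power2_eq_square algebra_simps)
    have inv: "?f (?g (u, v)) = (u, v)" if "(u - 2 * v) mod 5 = 0" for u v
    proof -
      define w where "w = (u - 2 * v) div 5"
      have u: "u = 2 * v + 5 * w"
        using mult_div_mod_eq[of 5 "u - 2 * v"] that by (simp add: w_def)
      have "2 * u + v = 5 * (v + 2 * w)" "u - 2 * v = 5 * w"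
        unfolding u by simp_all
      then have "?g (u, v) = (v + 2 * w, w)"
        by (simp only: prod.case) simp
      then show ?thesis by (simp add: u)
    qed
    have gf: "\<forall>p\<in>odd_reps 5 K. ?g (?f p) = p"
    proof
      fix p :: "int \<times> int"
      obtain x y where p: "p = (x, y)" by (cases p)
      show "?g (?f p) = p" unfolding p by simp
    qed
    have fg: "\<forall>q\<in>?R 0. ?f (?g q) = q"
    proof
      fix q assume "q \<in> ?R 0"
      then obtain u v where q: "q = (u, v)" "(u - 2 * v) mod 5 = 0" by (cases q) simp
      show "?f (?g q) = q" unfolding q(1) by (rule inv[OF q(2)])
    qed
    have fA: "?f ` odd_reps 5 K \<subseteq> ?R 0"
    proof
      fix q assume "q \<in> ?f ` odd_reps 5 K"
      then obtain x y where xy: "q = ?f (x, y)" "(x, y) \<in> odd_reps 5 K" by auto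
      then show "q \<in> ?R 0" using sum[of x y] by (simp add: odd_reps_def)
    qed
    have gB: "?g ` ?R 0 \<subseteq> odd_reps 5 K"
    proof
      fix p assume "p \<in> ?g ` ?R 0"
      then obtain u v where uv: "p = ?g (u, v)" "(u, v) \<in> ?R 0" by auto
      define x y where "x = (2 * u + v) div 5" and "y = (u - 2 * v) div 5"
      have e: "2 * x + y = u" "x - 2 * y = v"
        using inv[of u v] uv by (simp_all add: x_def y_def)
      then have "5 * (x\<^sup>2 + y\<^sup>2) = K"
        using sum[of x y] uv by (simp add: odd_reps_def)
      moreover have "odd x" "odd y" using e uv by (auto simp: odd_reps_def)
      ultimately show "p \<in> odd_reps 5 K" using uv by (simp add: odd_reps_def x_def y_def)
    qed
    show ?thesis
      by (rule bij_betw_same_card[OF bij_betw_byWitness[OF gf fg fA gB], symmetric])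
  qed
  finally show ?thesis by simp
qed

text \<open>Completing the square turns the condition into
  \<open>(4 * k - 1)\<^sup>2 = 8 * int m + 1\<close>. Of an odd \<open>z\<close> and
  \<open>-z\<close> exactly one is 3 modulo 4, so the count is 0 or 1.\<close>

lemma odd_card_theta_4_1:
  "odd (card {k. theta_exp 4 1 k = int m}) \<longleftrightarrow> (\<exists>z. 0 < z \<and> odd z \<and> z\<^sup>2 = 8 * int m + 1)"
proof -
  have sq: "theta_exp 4 1 k = int m \<longleftrightarrow> (4 * k - 1)\<^sup>2 = 8 * int m + 1" for k
    using two_theta_exp[of 4 1 k] by (auto simp: power2_eq_square algebra_simps)
  show ?thesis
  proof (cases "\<exists>z. 0 < z \<and> odd z \<and> z\<^sup>2 = 8 * int m + 1")
    case True
    then obtain z where z: "0 < z" "odd z" "z\<^sup>2 = 8 * int m + 1" by blast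
    define q r k where "q = z div 4" and "r = z mod 4" and "k = (if r = 3 then q + 1 else - q)"
    have qr: "z = 4 * q + r" by (simp add: q_def r_def)
    have "r = 1 \<or> r = 3" using z(2) unfolding r_def by presburger
    then have k: "4 * k - 1 = (if r = 3 then z else - z)"
      unfolding k_def qr by auto
    have "theta_exp 4 1 l = int m \<longleftrightarrow> l = k" for l
    proof -
      have "theta_exp 4 1 l = int m \<longleftrightarrow> 4 * l - 1 = z \<or> 4 * l - 1 = - z"
        unfolding sq z(3)[symmetric] by (rule power2_eq_iff)
      also have "\<dots> \<longleftrightarrow> l = k" using k by (auto split: if_splits) presburger+
      finally show ?thesis .
    qed
    then show ?thesis using True by simp
  next
    case False
    have "{k. theta_exp 4 1 k = int m} = {}"
    proof (rule ccontr)
      assume "{k. theta_exp 4 1 k = int m} \<noteq> {}"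
      then obtain k where "(4 * k - 1)\<^sup>2 = 8 * int m + 1" using sq by auto
      then have "0 < \<bar>4 * k - 1\<bar> \<and> odd \<bar>4 * k - 1\<bar> \<and> \<bar>4 * k - 1\<bar>\<^sup>2 = 8 * int m + 1"
        by (simp, presburger)
      then show False using False by blast
    qed
    then show ?thesis using False by (metis card.empty even_zero)
  qed
qed

lemma of_int_bit_eq_0_iff: "(of_int z :: bit) = 0 \<longleftrightarrow> even z"
proof (cases "even z")
  case True
  then show ?thesis by (auto elim!: evenE)
next
  case False
  then obtain w where "z = 2 * w + 1" by (rule oddE)
  then have "(of_int z :: bit) = 2 * of_int w + 1" by simp
  also have "\<dots> = 1" by (simp only: bit_2_eq_0 mult_zero_left add_0_left)
  finally show ?thesis using False by simp
qed

lemma of_nat_bit_eq_iff: "(of_nat m :: bit) = of_nat n \<longleftrightarrow> (odd m \<longleftrightarrow> odd n)"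
proof -
  have eq0: "(of_nat k :: bit) = 0 \<longleftrightarrow> even k" for k
    using of_int_bit_eq_0_iff[of "int k"] by simp
  have "x = y \<longleftrightarrow> (x = 0 \<longleftrightarrow> y = 0)" for x y :: bit
    by (cases x; cases y) simp_all
  from this[of "of_nat m" "of_nat n"] show ?thesis
    unfolding eq0 by blast
qed

text \<open>After division by 4, \<open>card ?S\<close> is the difference of the positive counts for
  \<open>d = 1\<close> and \<open>d = 5\<close>. The latter is even:
  \<open>5 * z\<^sup>2 = 8 * int m + 1\<close> is impossible modulo 8, which relies on the exponent
  being even. The former is odd exactly at triangular \<open>m\<close>.\<close>

lemma fps_nth_qpoch_inf_1_5_even:
  "fps_nth (qpoch_inf 1 * qpoch_inf 5 :: bit fps) (2 * m) = fps_nth (theta 4 1) m"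
proof -
  let ?K = "8 * int (2 * m) + 2"
  let ?S = "{(u, v). (u, v) \<in> odd_reps 1 ?K \<and> (u - 2 * v) mod 5 = 1}"
  have "4 * card (pos_odd_reps 1 ?K) = 4 * card (pos_odd_reps 5 ?K) + 4 * card ?S"
    using card_odd_reps_mod_5[of ?K] by (simp only: card_odd_reps zero_less_one zero_less_numeral)
  then have "card (pos_odd_reps 1 ?K) = card (pos_odd_reps 5 ?K) + card ?S" by simp
  moreover have "even (card (pos_odd_reps 5 ?K))"
  proof (rule ccontr)
    assume "odd (card (pos_odd_reps 5 ?K))"
    then obtain z where z: "odd z" "5 * (2 * z\<^sup>2) = ?K"
      using odd_card_pos_odd_reps[of 5 ?K] by auto
    obtain t where "z\<^sup>2 = 8 * t + 1" by (rule odd_square_eq[OF z(1)])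
    then have "10 * t + 1 = 2 * int m" using z(2) by linarith
    then show False by presburger
  qed
  ultimately have "odd (card ?S) \<longleftrightarrow> (\<exists>z. 0 < z \<and> odd z \<and> 1 * (2 * z\<^sup>2) = ?K)"
    using odd_card_pos_odd_reps[of 1 ?K] by simp
  also have "\<dots> \<longleftrightarrow> odd (card {k. theta_exp 4 1 k = int m})"
    unfolding odd_card_theta_4_1 by (intro ex_cong1) auto
  finally have "(of_nat (card ?S) :: bit) = of_nat (card {k. theta_exp 4 1 k = int m})"
    by (simp only: of_nat_bit_eq_iff)
  then show ?thesis
    unfolding qpoch_inf_1_5_eq_theta card_theta_5[symmetric]
    by (simp add: fps_nth_theta_mult) (simp add: theta_def)
qed

section \<open>Reduction modulo 2\<close>

text \<open>A factor in \<open>fps_X ^ d\<close> shifts exponents by multiples of \<open>d\<close>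
  only, so extracting the exponents divisible by \<open>d\<close> passes through it.\<close>

lemma fps_nth_mult_compose_X_power:
  fixes f g :: "'a::comm_ring_1 fps"
  assumes "0 < d"
  shows "fps_nth (f * (g oo fps_X ^ d)) (d * m) = fps_nth (Abs_fps (\<lambda>n. fps_nth f (d * n)) * g) m"
proof -
  have "fps_nth (f * (g oo fps_X ^ d)) (d * m) =
      (\<Sum>i\<in>{0..d * m}. fps_nth f i * fps_nth (g oo fps_X ^ d) (d * m - i))"
    by (rule fps_mult_nth)
  also have "\<dots> = (\<Sum>i\<in>(*) d ` {0..m}. fps_nth f i * fps_nth (g oo fps_X ^ d) (d * m - i))"
  proof (rule sum.mono_neutral_right)
    show "\<forall>i\<in>{0..d * m} - (*) d ` {0..m}. fps_nth f i * fps_nth (g oo fps_X ^ d) (d * m - i) = 0"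
    proof
      fix i assume i: "i \<in> {0..d * m} - (*) d ` {0..m}"
      have "\<not> d dvd d * m - i"
      proof
        assume "d dvd d * m - i"
        then have "d dvd d * m - (d * m - i)" by (rule dvd_diff_nat[OF dvd_triv_left])
        then have "d dvd i" using i by simp
        then obtain k where "i = d * k" by (rule dvdE)
        then show False using i assms by auto
      qed
      then show "fps_nth f i * fps_nth (g oo fps_X ^ d) (d * m - i) = 0"
        by (simp add: fps_nth_compose_X_power)
    qed
  qed (use assms in auto)
  also have "\<dots> = (\<Sum>i\<in>{0..m}. fps_nth f (d * i) * fps_nth g (m - i))"
  proof (subst sum.reindex)
    show "inj_on ((*) d) {0..m}" using assms by (simp add: inj_on_def)
    have "d * m - d * i = d * (m - i)" for i by (simp add: diff_mult_distrib2)
    then show "(\<Sum>i\<in>{0..m}. ((\<lambda>i. fps_nth f i * fps_nth (g oo fps_X ^ d) (d * m - i)) \<circ> (*) d) i)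
       = (\<Sum>i\<in>{0..m}. fps_nth f (d * i) * fps_nth g (m - i))"
      using assms by (simp add: fps_nth_compose_X_power)
  qed
  finally show ?thesis by (simp add: fps_mult_nth)
qed

lemma fps_nth_mult_compose_X_power_eq_0:
  fixes f g :: "'a::comm_ring_1 fps"
  assumes "\<And>i. i mod d = n mod d \<Longrightarrow> fps_nth f i = 0"
  shows "fps_nth (f * (g oo fps_X ^ d)) n = 0"
  unfolding fps_mult_nth
proof (rule sum.neutral, rule ballI)
  fix i assume i: "i \<in> {0..n}"
  show "fps_nth f i * fps_nth (g oo fps_X ^ d) (n - i) = 0"
  proof (cases "d dvd n - i")
    case True
    then have "i mod d = n mod d" using i by (simp add: mod_eq_dvd_iff_nat[symmetric])
    then show ?thesis using assms by simp
  next
    case False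
    then show ?thesis by (simp add: fps_nth_compose_X_power)
  qed
qed

text \<open>Pentagonal exponents satisfy \<open>2 * int n = 3 * (i * i) - i\<close>, whose values
  modulo 5 are 0, 2 and 4; hence \<open>n\<close> is 0, 1 or 2 modulo 5.\<close>

lemma qpoch_inf_1_nth_eq_0:
  assumes "n mod 5 = 3 \<or> n mod 5 = 4"
  shows "fps_nth (qpoch_inf 1 :: bit fps) n = 0"
proof -
  have "theta_exp 3 1 i \<noteq> int n" for i
  proof
    assume "theta_exp 3 1 i = int n"
    then have e: "2 * int n = 3 * (i * i) - i"
      using two_theta_exp[of 3 1 i] by (simp add: algebra_simps)
    define r q where "r = i mod 5" and "q = i div 5"
    have i: "i = 5 * q + r" by (simp add: r_def q_def)
    have "2 * int n = 5 * (15 * (q * q) + 6 * (q * r) - q) + (3 * (r * r) - r)"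
      unfolding e i by (simp add: algebra_simps)
    then have "2 * int n mod 5 = (3 * (r * r) - r) mod 5" by (simp only: mod_mult_self4)
    moreover have "r = 0 \<or> r = 1 \<or> r = 2 \<or> r = 3 \<or> r = 4" unfolding r_def by presburger
    ultimately have "2 * int n mod 5 = 0 \<or> 2 * int n mod 5 = 2 \<or> 2 * int n mod 5 = 4"
      by (elim disjE) simp_all
    then show False using assms by presburger
  qed
  then show ?thesis by (simp add: qpoch_inf_1_eq_theta[simplified] theta_def)
qed

lemma inverse_qpoch_inf_compose:
  assumes "0 < d" "0 < L"
  shows "inverse (qpoch_inf (d * L)) = (inverse (qpoch_inf L) oo fps_X ^ d :: 'a::field fps)"
  unfolding qpoch_inf_compose[OF assms] by (rule fps_inverse_compose[symmetric]) (use assms in simp_all)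

lemma qpoch_inf_bit_double:
  "qpoch_inf 2 = (qpoch_inf 1 ^ 2 :: bit fps)" "qpoch_inf 4 = (qpoch_inf 1 ^ 4 :: bit fps)"
  "qpoch_inf 10 = (qpoch_inf 5 ^ 2 :: bit fps)" "qpoch_inf 20 = (qpoch_inf 5 ^ 4 :: bit fps)"
  using qpoch_inf_double[of 1] qpoch_inf_double[of 2] qpoch_inf_double[of 5] qpoch_inf_double[of 10]
  by (simp_all flip: power_mult)

lemma inverse_fps_mult_unit:
  fixes f :: "'a::field fps"
  assumes "fps_nth f 0 = 1"
  shows "f * inverse f = 1"
  by (rule inverse_mult_eq_1') (use assms in simp)

text \<open>Since \<open>f\<^sub>1 f\<^sub>5 g\<^sup>2 = g\<close> for \<open>g = 1/(f\<^sub>1 f\<^sub>5)\<close> and \<open>g\<^sup>2\<close> is a series in \<open>q\<^sup>2\<close>, only the even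
  part of \<open>f\<^sub>1 f\<^sub>5\<close> contributes to the even coefficients of \<open>g\<close>.\<close>
lemma inverse_qpoch_inf_1_5_even:
  "fps_nth (inverse (qpoch_inf 1) * inverse (qpoch_inf 5) :: bit fps) (2 * m) =
   fps_nth (qpoch_inf 2 * inverse (qpoch_inf 5)) m"
proof -
  let ?f = "qpoch_inf 1 :: bit fps" and ?h = "qpoch_inf 5 :: bit fps"
  let ?g = "inverse ?f * inverse ?h"
  have f: "?f * inverse ?f = 1" and h: "?h * inverse ?h = 1"
    by (rule inverse_fps_mult_unit, simp)+
  have c0: "fps_nth (fps_X ^ 2 :: bit fps) 0 = 0" by simp
  have "?g oo fps_X ^ 2 = inverse (qpoch_inf 2) * inverse (qpoch_inf 10)"
    using inverse_qpoch_inf_compose[of 2 1, where ?'a = bit] inverse_qpoch_inf_compose[of 2 5, where ?'a = bit]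
    by (simp add: fps_compose_mult_distrib[OF c0])
  also have "\<dots> = (inverse ?f * inverse ?h) ^ 2"
    unfolding qpoch_inf_bit_double by (simp add: fps_inverse_power power_mult_distrib)
  finally have "?f * ?h * (?g oo fps_X ^ 2) = (?f * inverse ?f) * (?h * inverse ?h) * ?g"
    by (simp only: power2_eq_square mult_ac)
  then have "?g = ?f * ?h * (?g oo fps_X ^ 2)"
    unfolding f h by simp
  then have "fps_nth ?g (2 * m) = fps_nth (?f * ?h * (?g oo fps_X ^ 2)) (2 * m)"
    by (rule arg_cong)
  also have "\<dots> = fps_nth (theta 4 1 * ?g) m"
  proof -
    have "Abs_fps (\<lambda>n. fps_nth (?f * ?h) (2 * n)) = theta 4 1"
      by (rule fps_ext) (simp only: fps_nth_qpoch_inf_1_5_even fps_nth_Abs_fps)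
    then show ?thesis by (subst fps_nth_mult_compose_X_power) simp_all
  qed
  also have "theta 4 1 = ?f ^ 3"
  proof -
    have "?f \<noteq> 0" by (metis fps_zero_nth qpoch_inf_nth_0 zero_neq_one)
    then have "?f ^ 2 \<noteq> 0" by (rule power_not_zero)
    moreover have "theta 4 1 * ?f ^ 2 = ?f ^ 3 * ?f ^ 2"
      using theta_4_1 unfolding qpoch_inf_bit_double by (simp add: eval_nat_numeral mult_ac)
    ultimately show ?thesis by (rule mult_right_cancel[THEN iffD1])
  qed
  also have "?f ^ 3 * ?g = (?f * inverse ?f) * (?f ^ 2 * inverse ?h)"
    by (simp only: power3_eq_cube power2_eq_square mult_ac)
  also have "\<dots> = qpoch_inf 2 * inverse ?h"
    unfolding f qpoch_inf_bit_double by simp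
  finally show ?thesis .
qed

text \<open>\<open>inverse (qpoch_inf 5)\<close> is a series in \<open>fps_X ^ 5\<close>, so the
  exponents of \<open>qpoch_inf 2\<close> decide. These are even, and halving, which is
  multiplication by 3 modulo 5, sends the classes 1 and 3 to 3 and 4, where
  \<open>qpoch_inf 1\<close> vanishes.\<close>

lemma inverse_qpoch_inf_1_5_nth_eq_0:
  assumes "m mod 5 = 1 \<or> m mod 5 = 3"
  shows "fps_nth (inverse (qpoch_inf 1) * inverse (qpoch_inf 5) :: bit fps) (2 * m) = 0"
proof -
  have "inverse (qpoch_inf 5) = (inverse (qpoch_inf 1) oo fps_X ^ 5 :: bit fps)"
    using inverse_qpoch_inf_compose[of 5 1] by simp
  moreover have "fps_nth (qpoch_inf 2 :: bit fps) i = 0" if "i mod 5 = m mod 5" for i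
  proof (cases "even i")
    case True
    then have "3 * i mod 5 = (i div 2 + i div 2 * 5) mod 5" by (auto elim!: evenE)
    then have "i div 2 mod 5 = 3 * (i mod 5) mod 5"
      by (simp only: mod_mult_self1 mod_mult_right_eq)
    then have "i div 2 mod 5 = 3 \<or> i div 2 mod 5 = 4" using that assms by auto
    then show ?thesis
      using qpoch_inf_compose[of 2 1, where ?'a = bit] qpoch_inf_1_nth_eq_0[of "i div 2"]
      by (simp add: fps_nth_compose_X_power)
  next
    case False
    then show ?thesis
      using qpoch_inf_compose[of 2 1, where ?'a = bit] by (simp add: fps_nth_compose_X_power)
  qed
  ultimately show ?thesis
    unfolding inverse_qpoch_inf_1_5_even by (simp add: fps_nth_mult_compose_X_power_eq_0)
qed

section \<open>Integral lifts of the two functions and their parity\<close>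

text \<open>One integer series has two images: the one over the rationals gives the coefficients,
  the one over \<open>bit\<close> their parity.\<close>

definition of_int_fps :: "int fps \<Rightarrow> 'a::comm_ring_1 fps" where
  "of_int_fps f = Abs_fps (\<lambda>n. of_int (fps_nth f n))"

lemma fps_nth_of_int_fps [simp]: "fps_nth (of_int_fps f) n = of_int (fps_nth f n)"
  by (simp add: of_int_fps_def)

lemma of_int_fps_1 [simp]: "of_int_fps 1 = 1"
  by (rule fps_ext) simp

lemma of_int_fps_X [simp]: "of_int_fps fps_X = fps_X"
  by (rule fps_ext) simp

lemma of_int_fps_add [simp]: "of_int_fps (f + g) = of_int_fps f + of_int_fps g"
  by (rule fps_ext) simp

lemma of_int_fps_diff [simp]: "of_int_fps (f - g) = of_int_fps f - of_int_fps g"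
  by (rule fps_ext) simp

lemma of_int_fps_mult [simp]: "of_int_fps (f * g) = of_int_fps f * of_int_fps g"
  by (rule fps_ext) (simp add: fps_mult_nth)

lemma of_int_fps_power [simp]: "of_int_fps (f ^ n) = of_int_fps f ^ n"
  by (induction n) simp_all

lemma of_int_fps_numeral [simp]: "of_int_fps (numeral n) = numeral n"
  by (rule fps_ext) (simp add: fps_numeral_nth)

lemma of_int_fps_qpoch_inf [simp]: "of_int_fps (qpoch_inf L) = qpoch_inf L"
proof -
  have "of_int_fps (qpoch_upto L n) = qpoch_upto L n" for n
    by (induction n) (simp_all del: power_Suc mult_Suc_right)
  then have "of_int (fps_nth (qpoch_upto L n) n) = fps_nth (qpoch_upto L n) n" for n
    by (metis fps_nth_of_int_fps)
  then show ?thesis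
    by (intro fps_ext) (simp add: qpoch_inf_def)
qed

text \<open>The integers are not a field, but the constant coefficient is 1; the second argument of
  \<open>fps_right_inverse\<close> is the inverse of that coefficient.\<close>

definition inverse_qpoch :: "nat \<Rightarrow> int fps" where
  "inverse_qpoch L = fps_right_inverse (qpoch_inf L) 1"

lemma of_int_fps_inverse_qpoch [simp]:
  "of_int_fps (inverse_qpoch L) = (inverse (qpoch_inf L) :: 'a::field fps)"
proof -
  have "qpoch_inf L * inverse_qpoch L = 1"
    unfolding inverse_qpoch_def by (rule fps_right_inverse) simp
  then have "qpoch_inf L * of_int_fps (inverse_qpoch L) = (1 :: 'a fps)"
    by (metis of_int_fps_1 of_int_fps_mult of_int_fps_qpoch_inf)
  then have "inverse (qpoch_inf L) * (qpoch_inf L * of_int_fps (inverse_qpoch L)) = inverse (qpoch_inf L :: 'a fps)"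
    by simp
  then show ?thesis
    by (simp add: inverse_mult_eq_1 flip: mult.assoc)
qed

lemma E_eq: "E k = fps_to_fls (qpoch_inf k)"
  by (simp add: E_def qpoch_def qpoch_inf_def qpoch_upto_def)

lemma inverse_E: "inverse (E k) = fps_to_fls (inverse (qpoch_inf k))"
proof (rule inverse_unique)
  show "E k * fps_to_fls (inverse (qpoch_inf k)) = 1"
    unfolding E_eq fls_times_fps_to_fls[symmetric] by (subst inverse_fps_mult_unit) simp_all
qed

lemma fls_nth_X_inv_times_fps:
  "0 \<le> n + 1 \<Longrightarrow> fls_nth (fls_X_inv * fps_to_fls f) n = fps_nth (f :: 'a::field fps) (nat (n + 1))"
  by (simp add: fls_X_inv_times_conv_shift)

lemma even_fps_nth_iff: "even (fps_nth f n) \<longleftrightarrow> fps_nth (of_int_fps f :: bit fps) n = 0"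
  by (simp add: of_int_bit_eq_0_iff)

text \<open>The integral power series for q times \<open>j10 + 1\<close>.\<close>

definition j10_int :: "int fps" where
  "j10_int = qpoch_inf 2 * qpoch_inf 5 ^ 5 * (inverse_qpoch 1 * inverse_qpoch 10 ^ 5)"

lemma j10_eq: "j10 = fls_X_inv * fps_to_fls (of_int_fps j10_int) - 1"
  unfolding j10_def j10_int_def
  by (simp add: divide_inverse power_inverse[symmetric] inverse_E fls_times_fps_to_fls fps_to_fls_power)
     (simp add: E_eq)

text \<open>With \<open>f = qpoch_inf 1\<close> and \<open>h = qpoch_inf 5\<close>, doubling gives
  \<open>f ^ 2 * h ^ 5 / (f * h ^ 10) = f / h ^ 5\<close>, and \<open>h\<close> is \<open>f\<close>
  evaluated at \<open>fps_X ^ 5\<close>.\<close>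

lemma j10_int_mod_2: "of_int_fps j10_int = (qpoch_inf 1 * (inverse (qpoch_inf 1) ^ 5 oo fps_X ^ 5) :: bit fps)"
proof -
  let ?f = "qpoch_inf 1 :: bit fps" and ?h = "qpoch_inf 5 :: bit fps"
  have f: "?f * inverse ?f = 1" and h: "?h * inverse ?h = 1"
    by (rule inverse_fps_mult_unit, simp)+
  have "(of_int_fps j10_int :: bit fps) = ?f ^ 2 * ?h ^ 5 * (inverse ?f * inverse ?h ^ 10)"
    unfolding j10_int_def
    by (simp add: qpoch_inf_bit_double[simplified] fps_inverse_power flip: power_mult)
  also have "\<dots> = ?f * (?f * inverse ?f) * (?h * inverse ?h) ^ 5 * inverse ?h ^ 5"
    by (simp add: power_mult_distrib eval_nat_numeral mult_ac)
  also have "\<dots> = ?f * inverse ?h ^ 5"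
    unfolding f h by simp
  also have "inverse ?h = inverse ?f oo fps_X ^ 5"
    using inverse_qpoch_inf_compose[of 5 1, where ?'a = bit] by simp
  also have "(inverse ?f oo fps_X ^ 5) ^ 5 = inverse ?f ^ 5 oo fps_X ^ 5"
    by (rule fps_compose_power) simp
  finally show ?thesis .
qed

text \<open>The integral power series for q times \<open>j10star\<close>, whence
  \<open>4 * fps_X\<close> and the square of \<open>fps_X\<close>.\<close>

definition j10star_int :: "int fps" where
  "j10star_int = (qpoch_inf 1 * qpoch_inf 5 * (inverse_qpoch 2 * inverse_qpoch 10)) ^ 4
     + 4 * fps_X + 2 ^ 4 * (fps_X ^ 2 * (qpoch_inf 2 * qpoch_inf 10 * (inverse_qpoch 1 * inverse_qpoch 5)) ^ 4)"

lemma j10star_eq: "j10star = fls_X_inv * fps_to_fls (of_int_fps j10star_int)"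
proof -
  have X: "fls_X_inv * fls_X = (1 :: rat fls)"
    by (simp add: fls_X_inv_times_conv_shift)
  define A B where "A = E 1 * E 5 / (E 2 * E 10)" and "B = E 2 * E 10 / (E 1 * E 5)"
  have "fps_to_fls (of_int_fps j10star_int) = A ^ 4 + 4 * fls_X + 2 ^ 4 * (fls_X ^ 2 * B ^ 4)"
    unfolding j10star_int_def A_def B_def
    by (simp add: divide_inverse inverse_E fls_times_fps_to_fls fps_to_fls_power) (simp add: E_eq)
  then have "fls_X_inv * fps_to_fls (of_int_fps j10star_int) =
      fls_X_inv * A ^ 4 + 4 * (fls_X_inv * fls_X) + 2 ^ 4 * ((fls_X_inv * fls_X) * (fls_X * B ^ 4))"
    by (simp only: power2_eq_square distrib_left mult_ac)
  then show ?thesis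
    unfolding X j10star_def A_def[symmetric] B_def[symmetric] by simp
qed

text \<open>The terms with factors 4 and 16 vanish. The first is the fourth power of
  \<open>f * h / (f ^ 2 * h ^ 2) = 1 / (f * h)\<close>, and in characteristic two this power
  substitutes \<open>fps_X ^ 4\<close>.\<close>

lemma j10star_int_mod_2:
  "of_int_fps j10star_int = ((inverse (qpoch_inf 1) * inverse (qpoch_inf 5)) oo fps_X ^ 4 :: bit fps)"
proof -
  let ?f = "qpoch_inf 1 :: bit fps" and ?h = "qpoch_inf 5 :: bit fps"
  have f: "?f * inverse ?f = 1" and h: "?h * inverse ?h = 1"
    by (rule inverse_fps_mult_unit, simp)+
  have c0: "fps_nth (fps_X ^ 4 :: bit fps) 0 = 0" by simp
  have "(4 :: bit fps) = 2 * 2" "(16 :: bit fps) = 2 * 8" by simp_all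
  then have vanish: "(4 :: bit fps) = 0" "(16 :: bit fps) = 0"
    by (simp_all only: bit_fps_two_eq_0 mult_zero_left)
  have "(of_int_fps j10star_int :: bit fps) = (?f * ?h * (inverse ?f ^ 2 * inverse ?h ^ 2)) ^ 4"
    unfolding j10star_int_def
    by (simp add: vanish qpoch_inf_bit_double[simplified] fps_inverse_power)
  also have "?f * ?h * (inverse ?f ^ 2 * inverse ?h ^ 2) = (?f * inverse ?f) * (?h * inverse ?h) * (inverse ?f * inverse ?h)"
    by (simp only: power2_eq_square mult_ac)
  also have "\<dots> ^ 4 = inverse (qpoch_inf 4) * inverse (qpoch_inf 20)"
    unfolding f h qpoch_inf_bit_double by (simp add: power_mult_distrib fps_inverse_power)
  also have "\<dots> = (inverse ?f * inverse ?h) oo fps_X ^ 4"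
    using inverse_qpoch_inf_compose[of 4 1, where ?'a = bit] inverse_qpoch_inf_compose[of 4 5, where ?'a = bit]
    by (simp add: fps_compose_mult_distrib[OF c0])
  finally show ?thesis .
qed

theorem theorem1p6:
  fixes i n :: int
  assumes "i \<in> {7, 23}" and "n > 0"
  shows "(\<exists>a::int. J10 (40 * n + i) = 2 * of_int a) \<and>
         (\<exists>b::int. J10star (40 * n + i) = 2 * of_int b)"
proof
  \<comment> \<open>The shift by one comes from the factor 1/q. It turns the indices into
    \<open>8 * (5 * n + 1)\<close> and \<open>8 * (5 * n + 3)\<close>.\<close>
  define k where "k = nat (40 * n + i + 1)"
  define p where "p = nat n"
  have n: "n = int p" using assms(2) by (simp add: p_def)
  have "k = 8 * (5 * p + 1) \<or> k = 8 * (5 * p + 3)"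
    using assms(1) unfolding k_def n by auto
  then obtain m where m: "k = 8 * m" "m mod 5 = 1 \<or> m mod 5 = 3"
  proof (elim disjE)
    assume "k = 8 * (5 * p + 1)"
    then show ?thesis by (rule that) simp
  next
    assume "k = 8 * (5 * p + 3)"
    then show ?thesis by (rule that) simp
  qed
  \<comment> \<open>The 1 subtracted in \<open>j10\<close> affects the coefficient at 0, so that
    index has to be excluded.\<close>
  have k0: "0 \<le> 40 * n + i + 1" "40 * n + i \<noteq> 0"
    using assms by auto
  have half: "\<exists>a::int. (of_int z :: rat) = 2 * of_int a" if "even z" for z :: int
    using that by (elim evenE) auto
  have "fps_nth (of_int_fps j10_int :: bit fps) k = 0"
    unfolding j10_int_mod_2
  proof (rule fps_nth_mult_compose_X_power_eq_0)
    fix j assume "j mod 5 = k mod 5"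
    \<comment> \<open>Since 8 is 3 modulo 5, the residues 1 and 3 of \<open>m\<close> give 3 and 4
      for \<open>k\<close>.\<close>
    also have "k mod 5 = 8 * (m mod 5) mod 5" by (simp only: m(1) mod_mult_right_eq)
    finally have "j mod 5 = 3 \<or> j mod 5 = 4" using m(2) by auto
    then show "fps_nth (qpoch_inf 1 :: bit fps) j = 0" by (rule qpoch_inf_1_nth_eq_0)
  qed
  then have "even (fps_nth j10_int k)" by (simp only: even_fps_nth_iff)
  moreover have "J10 (40 * n + i) = of_int (fps_nth j10_int k)"
    using k0 by (simp add: J10_def j10_eq fls_nth_X_inv_times_fps k_def)
  ultimately show "\<exists>a::int. J10 (40 * n + i) = 2 * of_int a"
    using half by simp
  \<comment> \<open>As \<open>k = 4 * (2 * m)\<close>, this is coefficient \<open>2 * m\<close>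
    before the substitution of \<open>fps_X ^ 4\<close>.\<close>
  have "fps_nth (of_int_fps j10star_int :: bit fps) k = 0"
    unfolding j10star_int_mod_2 fps_nth_compose_X_power
    using inverse_qpoch_inf_1_5_nth_eq_0[OF m(2)] m(1) by simp
  then have "even (fps_nth j10star_int k)" by (simp only: even_fps_nth_iff)
  moreover have "J10star (40 * n + i) = of_int (fps_nth j10star_int k)"
    using k0 by (simp add: J10star_def j10star_eq fls_nth_X_inv_times_fps k_def)
  ultimately show "\<exists>b::int. J10star (40 * n + i) = 2 * of_int b"
    using half by simp
qed

end
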